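(* Let $\mathcal{E}$ be a set of isomorphism classes of simple graphs on $n$ vertices that is closed under taking subgraphs (deleting edges), and let $\mathcal{C}\subseteq\mathcal{E}$ be the set of members of $\mathcal{E}$ that are connected. Then $\mathcal{C}$ generates/separates $\mathcal{E}$: for $x,y\in\mathcal{E}$, if $I(c)(x)=I(c)(y)$ for all $c\in\mathcal{C}$ then $x\cong y$; equivalently, for every $h\in\mathcal{E}$ there is a function $f$ with $I(h)(x)=f\big((I(c)(x))_{c\in\mathcal{C}}\big)$ for all $x\in\mathcal{E}$.
   Context: For simple graphs $g,x$ on $n$ vertices, $I(g)(x)$ is the number of subgraphs of $x$ (subsets of its edge set, on the same vertex set) isomorphic to $g$. A graph is called connected here if it has at least one edge and its edges (with their endpoints) form a connected graph; the remaining vertices are isolated. *)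

theory Defs
  imports "HOL-Library.FuncSet"
begin

text \<open>All graphs in play share the vertex set \<open>{..<n}\<close>, so a graph is identified with its edge set.\<close>

type_synonym graph = "nat set set"

definition simple_graphs :: "nat \<Rightarrow> graph set" where
  "simple_graphs n = {g. \<forall>e\<in>g. e \<subseteq> {..<n} \<and> card e = 2}"

definition graph_iso :: "nat \<Rightarrow> graph \<Rightarrow> graph \<Rightarrow> bool" where
  "graph_iso n g h \<longleftrightarrow> (\<exists>p. bij_betw p {..<n} {..<n} \<and> h = (\<lambda>e. p ` e) ` g)"

definition iso_rel :: "nat \<Rightarrow> graph rel" where
  "iso_rel n = {(g, h). g \<in> simple_graphs n \<and> h \<in> simple_graphs n \<and> graph_iso n g h}"

abbreviation iso_classes :: "nat \<Rightarrow> graph set set" where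
  "iso_classes n \<equiv> simple_graphs n // iso_rel n"

abbreviation iso_class :: "nat \<Rightarrow> graph \<Rightarrow> graph set" where
  "iso_class n g \<equiv> iso_rel n `` {g}"

text \<open>At least one edge, and any two non-isolated vertices are joined by a walk; isolated vertices
  are ignored.\<close>

definition connected_graph :: "graph \<Rightarrow> bool" where
  "connected_graph g \<longleftrightarrow> g \<noteq> {} \<and> (\<forall>u\<in>\<Union>g. \<forall>v\<in>\<Union>g. (u, v) \<in> {(a, b). {a, b} \<in> g}\<^sup>*)"

definition connected_class :: "graph set \<Rightarrow> bool" where
  "connected_class c \<longleftrightarrow> (\<exists>g\<in>c. connected_graph g)"

definition subgraph_count :: "nat \<Rightarrow> graph \<Rightarrow> graph \<Rightarrow> nat" where
  "subgraph_count n g x = card {s. s \<subseteq> x \<and> graph_iso n g s}"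

text \<open>The counting invariant on isomorphism classes; \<open>class_count_eq\<close> below shows that the choice of
  representatives is immaterial.\<close>

definition class_count :: "nat \<Rightarrow> graph set \<Rightarrow> graph set \<Rightarrow> nat" where
  "class_count n c x = subgraph_count n (SOME g. g \<in> c) (SOME h. h \<in> x)"

definition subgraph_closed :: "nat \<Rightarrow> graph set set \<Rightarrow> bool" where
  "subgraph_closed n \<E> \<longleftrightarrow> (\<forall>x\<in>\<E>. \<forall>g\<in>x. \<forall>h. h \<subseteq> g \<longrightarrow> iso_class n h \<in> \<E>)"

lemma graph_iso_refl: "graph_iso n g g"
  unfolding graph_iso_def by (rule exI[of _ id]) auto

lemma graph_iso_trans:
  assumes "graph_iso n g h" "graph_iso n h k"
  shows "graph_iso n g k"
proof -
  obtain p q where p: "bij_betw p {..<n} {..<n}" "h = (\<lambda>e. p ` e) ` g"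
    and q: "bij_betw q {..<n} {..<n}" "k = (\<lambda>e. q ` e) ` h"
    using assms unfolding graph_iso_def by blast
  have "bij_betw (q \<circ> p) {..<n} {..<n}" "k = (\<lambda>e. (q \<circ> p) ` e) ` g"
    using p q by (auto intro: bij_betw_trans simp: image_image image_comp)
  then show ?thesis unfolding graph_iso_def by blast
qed

lemma image_image_inverse:
  assumes "\<And>v. v \<in> V \<Longrightarrow> q (p v) = v" "\<And>e. e \<in> g \<Longrightarrow> e \<subseteq> V"
  shows "(\<lambda>e. q ` e) ` (\<lambda>e. p ` e) ` g = g"
proof -
  have "q ` p ` e = e" if "e \<in> g" for e
    using assms(1) assms(2)[OF that] by (force simp: image_image)
  then show ?thesis by (simp add: image_image)
qed

lemma graph_iso_sym:
  assumes "g \<in> simple_graphs n" "graph_iso n g h"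
  shows "graph_iso n h g"
proof -
  obtain p where p: "bij_betw p {..<n} {..<n}" "h = (\<lambda>e. p ` e) ` g"
    using assms unfolding graph_iso_def by blast
  have "(\<lambda>e. inv_into {..<n} p ` e) ` h = g"
    unfolding p(2) using assms(1) p(1)
    by (intro image_image_inverse[of "{..<n}"])
      (auto simp: simple_graphs_def bij_betw_inv_into_left)
  then show ?thesis
    using bij_betw_inv_into[OF p(1)] unfolding graph_iso_def by blast
qed

lemma equiv_iso_rel: "equiv (simple_graphs n) (iso_rel n)"
  by (rule equivI)
    (auto simp: iso_rel_def refl_on_def sym_def trans_def
      intro: graph_iso_refl graph_iso_sym graph_iso_trans)

lemma iso_class_eq_iff:
  assumes "g \<in> simple_graphs n" "h \<in> simple_graphs n"
  shows "iso_class n g = iso_class n h \<longleftrightarrow> graph_iso n g h"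
  using eq_equiv_class_iff[OF equiv_iso_rel assms] assms by (simp add: iso_rel_def)

lemma subgraph_count_le:
  assumes g: "g \<in> simple_graphs n" and x: "x \<in> simple_graphs n"
    and gg': "graph_iso n g g'" and xx': "graph_iso n x x'"
  shows "subgraph_count n g x \<le> subgraph_count n g' x'"
proof -
  obtain p where p: "bij_betw p {..<n} {..<n}" "x' = (\<lambda>e. p ` e) ` x"
    using xx' unfolding graph_iso_def by blast
  let ?F = "\<lambda>s. (\<lambda>e. p ` e) ` s"
  let ?A = "{s. s \<subseteq> x \<and> graph_iso n g s}" and ?B = "{s. s \<subseteq> x' \<and> graph_iso n g' s}"
  have "x \<subseteq> Pow {..<n}"
    using x by (auto simp: simple_graphs_def)
  then have fin: "finite x"
    by (rule finite_subset) simp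
  have inj: "inj_on ?F ?A"
  proof (rule inj_on_inverseI)
    fix s assume "s \<in> ?A"
    then show "(\<lambda>e. inv_into {..<n} p ` e) ` ?F s = s"
      using x p(1) by (intro image_image_inverse[of "{..<n}"])
        (auto simp: simple_graphs_def bij_betw_inv_into_left)
  qed
  have "?F ` ?A \<subseteq> ?B"
  proof clarify
    fix s assume s: "s \<subseteq> x" "graph_iso n g s"
    have "graph_iso n s (?F s)"
      using p(1) unfolding graph_iso_def by blast
    then have "graph_iso n g' (?F s)"
      using graph_iso_sym[OF g gg'] s(2) graph_iso_trans by blast
    then show "?F s \<subseteq> x' \<and> graph_iso n g' (?F s)"
      using s(1) p(2) by blast
  qed
  moreover have "finite ?B"
    using fin p(2) by simp
  ultimately show ?thesis
    unfolding subgraph_count_def using card_inj_on_le[OF inj] by blast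
qed

lemma class_count_eq:
  assumes "c \<in> iso_classes n" "x \<in> iso_classes n" "g \<in> c" "h \<in> x"
  shows "class_count n c x = subgraph_count n g h"
proof -
  have rel: "(a, b) \<in> iso_rel n" if "k \<in> iso_classes n" "a \<in> k" "b \<in> k" for k a b
    using quotient_eq_iff[OF equiv_iso_rel that(1,1,2,3)] by simp
  have "(SOME g. g \<in> c) \<in> c" "(SOME h. h \<in> x) \<in> x"
    using assms(3,4) by (auto intro: someI)
  then have "(g, SOME g. g \<in> c) \<in> iso_rel n" "((SOME g. g \<in> c), g) \<in> iso_rel n"
    "(h, SOME h. h \<in> x) \<in> iso_rel n" "((SOME h. h \<in> x), h) \<in> iso_rel n"
    using rel assms by auto
  then show ?thesis
    unfolding class_count_def iso_rel_def by (auto intro!: antisym subgraph_count_le)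
qed

lemma connected_graph_iso:
  assumes "connected_graph g" "graph_iso n g h"
  shows "connected_graph h"
proof -
  obtain p where h: "h = (\<lambda>e. p ` e) ` g"
    using assms(2) unfolding graph_iso_def by blast
  have walk: "(p u, p v) \<in> {(a, b). {a, b} \<in> h}\<^sup>*" if "(u, v) \<in> {(a, b). {a, b} \<in> g}\<^sup>*" for u v
    using that
  proof induction
    case base
    show ?case by simp
  next
    case (step v w)
    then have "p ` {v, w} \<in> h"
      unfolding h by blast
    then have "(p v, p w) \<in> {(a, b). {a, b} \<in> h}"
      by simp
    with step.IH show ?case
      by (rule rtrancl_into_rtrancl)
  qed
  have "h \<noteq> {}"
    using assms(1) unfolding connected_graph_def h by blast
  moreover have "(u, v) \<in> {(a, b). {a, b} \<in> h}\<^sup>*" if uv: "u \<in> \<Union>h" "v \<in> \<Union>h" for u v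
  proof -
    obtain u' v' where "u' \<in> \<Union>g" "u = p u'" "v' \<in> \<Union>g" "v = p v'"
      using uv unfolding h by blast
    then show ?thesis
      using walk assms(1) unfolding connected_graph_def by blast
  qed
  ultimately show ?thesis
    unfolding connected_graph_def by blast
qed

lemma connected_class_iff:
  assumes "c \<in> iso_classes n" "g \<in> c"
  shows "connected_class c \<longleftrightarrow> connected_graph g"
proof -
  have "graph_iso n k g" if "k \<in> c" for k
    using quotient_eq_iff[OF equiv_iso_rel assms(1,1) that assms(2)] by (simp add: iso_rel_def)
  then show ?thesis
    using assms(2) connected_graph_iso unfolding connected_class_def by blast
qed

end

theory Submission
  imports Defs
begin

text \<open>A connected subgraph with the maximal number of edges is a connected component.
  If \<open>x\<close> and \<open>y\<close> contain every connected graph equally often, then a largest component \<open>c\<close> of \<open>x\<close>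
  has an isomorphic copy \<open>c'\<close> in \<open>y\<close>, which is a largest component of \<open>y\<close>. Counts of connected
  graphs are additive over disjoint unions, so \<open>x - c\<close> and \<open>y - c'\<close> again have equal counts, are
  isomorphic by induction, and the two isomorphisms glue. A connected graph outside the
  subgraph-closed family occurs in no member of it, so only counts from the family matter.\<close>

section \<open>Finiteness, and counts under isomorphism\<close>

lemma finite_simple_graph:
  assumes "x \<in> simple_graphs n"
  shows "finite x"
proof (rule finite_subset)
  show "x \<subseteq> Pow {..<n}"
    using assms by (auto simp: simple_graphs_def)
qed simp

lemma simple_graphs_subset: "x \<in> simple_graphs n \<Longrightarrow> s \<subseteq> x \<Longrightarrow> s \<in> simple_graphs n"
  by (auto simp: simple_graphs_def)

lemma Union_simple_graph_subset: "x \<in> simple_graphs n \<Longrightarrow> \<Union>x \<subseteq> {..<n}"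
  by (auto simp: simple_graphs_def)

text \<open>Taking images never increases the number of edges; applying this to the isomorphism and
  to its inverse gives equality.\<close>

lemma graph_iso_card_eq:
  assumes "g \<in> simple_graphs n" "h \<in> simple_graphs n" "graph_iso n g h"
  shows "card g = card h"
proof -
  have "card k' \<le> card k" if "k \<in> simple_graphs n" "graph_iso n k k'" for k k'
    using that(2) card_image_le[OF finite_simple_graph[OF that(1)]]
    unfolding graph_iso_def by blast
  then show ?thesis
    using assms graph_iso_sym by (meson antisym)
qed

lemma subgraph_count_cong:
  assumes "g \<in> simple_graphs n" "h \<in> simple_graphs n" "x \<in> simple_graphs n" "graph_iso n g h"
  shows "subgraph_count n g x = subgraph_count n h x"
  using assms subgraph_count_le graph_iso_refl graph_iso_sym by (meson antisym)

lemma subgraph_count_pos_iff: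
  assumes "x \<in> simple_graphs n"
  shows "0 < subgraph_count n g x \<longleftrightarrow> (\<exists>s\<subseteq>x. graph_iso n g s)"
  using finite_simple_graph[OF assms] unfolding subgraph_count_def
  by (auto simp: card_gt_0_iff)

text \<open>The given isomorphisms are permutations of all of \<open>{..<n}\<close> and may
  disagree, so each is kept only on the non-isolated vertices of its own graph. These restrictions
  are then completed to one permutation.\<close>

lemma graph_iso_disjoint_Un:
  assumes a: "a \<in> simple_graphs n" and a': "a' \<in> simple_graphs n"
    and b: "b \<in> simple_graphs n" and b': "b' \<in> simple_graphs n"
    and "graph_iso n a a'" "graph_iso n b b'"
    and disj: "\<Union>a \<inter> \<Union>b = {}" and disj': "\<Union>a' \<inter> \<Union>b' = {}"
  shows "graph_iso n (a \<union> b) (a' \<union> b')"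
proof -
  let ?V = "{..<n}"
  obtain p q where p: "bij_betw p ?V ?V" "a' = (\<lambda>e. p ` e) ` a"
    and q: "bij_betw q ?V ?V" "b' = (\<lambda>e. q ` e) ` b"
    using assms(5,6) unfolding graph_iso_def by blast
  have pa: "bij_betw p (\<Union>a) (\<Union>a')"
    by (rule bij_betw_subset[OF p(1) Union_simple_graph_subset[OF a]]) (auto simp: p(2))
  have qb: "bij_betw q (\<Union>b) (\<Union>b')"
    by (rule bij_betw_subset[OF q(1) Union_simple_graph_subset[OF b]]) (auto simp: q(2))
  have sub: "\<Union>a \<union> \<Union>b \<subseteq> ?V" "\<Union>a' \<union> \<Union>b' \<subseteq> ?V"
    using a b a' b' by (simp_all add: Union_simple_graph_subset)
  define pq where "pq = (\<lambda>v. if v \<in> \<Union>a then p v else q v)"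
  have pq: "bij_betw pq (\<Union>a \<union> \<Union>b) (\<Union>a' \<union> \<Union>b')"
    unfolding pq_def by (rule bij_betw_disjoint_Un[OF pa qb disj disj'])
  have "card (\<Union>a \<union> \<Union>b) = card (\<Union>a' \<union> \<Union>b')"
    by (rule bij_betw_same_card[OF pq])
  then have "card (?V - (\<Union>a \<union> \<Union>b)) = card (?V - (\<Union>a' \<union> \<Union>b'))"
    using card_Diff_subset[OF finite_subset[OF sub(1)] sub(1)]
      card_Diff_subset[OF finite_subset[OF sub(2)] sub(2)] by simp
  \<comment> \<open>Equally many vertices are left over on both sides. No edge touches them, so any
    bijection between them will do.\<close>
  then obtain t where t: "bij_betw t (?V - (\<Union>a \<union> \<Union>b)) (?V - (\<Union>a' \<union> \<Union>b'))"
    by (metis finite_Diff finite_lessThan finite_same_card_bij)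
  define r where "r = (\<lambda>v. if v \<in> \<Union>a \<union> \<Union>b then pq v else t v)"
  have "bij_betw r (\<Union>a \<union> \<Union>b \<union> (?V - (\<Union>a \<union> \<Union>b))) (\<Union>a' \<union> \<Union>b' \<union> (?V - (\<Union>a' \<union> \<Union>b')))"
    unfolding r_def by (rule bij_betw_disjoint_Un[OF pq t]) auto
  then have r: "bij_betw r ?V ?V"
    using sub by (simp add: Un_absorb1)
  have "r ` e = p ` e" if "e \<in> a" for e
    using that by (intro image_cong) (auto simp: r_def pq_def)
  moreover have "r ` e = q ` e" if "e \<in> b" for e
    using that disj by (intro image_cong) (auto simp: r_def pq_def)
  ultimately have "a' \<union> b' = (\<lambda>e. r ` e) ` (a \<union> b)"
    unfolding p(2) q(2) by (simp add: image_Un)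
  with r show ?thesis
    unfolding graph_iso_def by blast
qed

section \<open>Connected subgraphs and components\<close>

text \<open>Adjacency is symmetric, so walks from a single root \<open>w\<close> can be reversed and
  joined to link any two vertices.\<close>

lemma connected_graphI:
  assumes "g \<noteq> {}" and reach: "\<And>v. v \<in> \<Union>g \<Longrightarrow> (w, v) \<in> {(a, b). {a, b} \<in> g}\<^sup>*"
  shows "connected_graph g"
proof -
  have "sym {(a, b). {a, b} \<in> g}"
    by (auto simp: sym_def insert_commute)
  then have "sym ({(a, b). {a, b} \<in> g}\<^sup>*)"
    by (rule sym_rtrancl)
  then show ?thesis
    unfolding connected_graph_def using assms by (meson symD rtrancl_trans)
qed

lemma connected_graph_single_edge:
  assumes "card e = 2"
  shows "connected_graph {e}"
proof -
  obtain u v where "e = {u, v}"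
    using assms by (auto simp: card_2_iff)
  then show ?thesis
    by (intro connected_graphI[of _ u]) auto
qed

text \<open>Take the shared vertex \<open>w\<close> as root: vertices of \<open>c\<close> are
  reached inside \<open>c\<close>, the other end of \<open>e\<close> in one step.\<close>

lemma connected_graph_insert_edge:
  assumes c: "connected_graph c" and "card e = 2" "w \<in> e" "w \<in> \<Union>c"
  shows "connected_graph (insert e c)"
proof (rule connected_graphI)
  fix v assume v: "v \<in> \<Union>(insert e c)"
  show "(w, v) \<in> {(a, b). {a, b} \<in> insert e c}\<^sup>*"
  proof (cases "v \<in> \<Union>c")
    case True
    then have "(w, v) \<in> {(a, b). {a, b} \<in> c}\<^sup>*"
      using c assms(4) unfolding connected_graph_def by blast
    then show ?thesis
      by (rule rtrancl_mono[THEN subsetD, rotated]) auto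
  next
    case False
    then have "v \<in> e" "v \<noteq> w"
      using v assms(4) by auto
    then have "e = {w, v}"
      using assms(2,3) by (auto simp: card_2_iff)
    then show ?thesis
      by (intro r_into_rtrancl) simp
  qed
qed simp

text \<open>An edge outside \<open>c\<close> that touches \<open>c\<close> could be added to it,
  giving a larger connected subgraph.\<close>

lemma maximal_connected_subgraph_disjoint:
  assumes x: "x \<in> simple_graphs n" and c: "c \<subseteq> x" "connected_graph c"
    and max: "\<And>d. d \<subseteq> x \<Longrightarrow> connected_graph d \<Longrightarrow> card d \<le> card c"
  shows "\<Union>c \<inter> \<Union>(x - c) = {}"
proof (rule ccontr)
  assume "\<Union>c \<inter> \<Union>(x - c) \<noteq> {}"
  then obtain w e where e: "w \<in> \<Union>c" "w \<in> e" "e \<in> x" "e \<notin> c"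
    by blast
  moreover have "card e = 2"
    using e(3) x by (simp add: simple_graphs_def)
  ultimately have "connected_graph (insert e c)"
    using connected_graph_insert_edge c(2) by blast
  then have "card (insert e c) \<le> card c"
    using max e(3) c(1) by simp
  then show False
    using e(4) finite_subset[OF c(1) finite_simple_graph[OF x]] by simp
qed

text \<open>A walk in \<open>s\<close> that starts in an edge of \<open>c\<close> stays in
  \<open>\<Union>c\<close>, since no edge meets both sides. The empty edge is excluded because walks
  cannot tie it to either side.\<close>

lemma connected_subgraph_disjoint_Un:
  assumes s: "connected_graph s" "s \<subseteq> c \<union> d" "{} \<notin> s" and disj: "\<Union>c \<inter> \<Union>d = {}"
  shows "s \<subseteq> c \<or> s \<subseteq> d"
proof (rule disjCI)
  assume "\<not> s \<subseteq> d"
  then obtain e where e: "e \<in> s" "e \<in> c"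
    using s(2) by blast
  obtain u where u: "u \<in> e"
    using e(1) s(3) by (metis ex_in_conv)
  have reach: "v \<in> \<Union>c" if "(u, v) \<in> {(a, b). {a, b} \<in> s}\<^sup>*" for v
    using that
  proof induction
    case base
    show ?case using e(2) u by blast
  next
    case (step v w)
    then show ?case
      using s(2) disj by blast
  qed
  show "s \<subseteq> c"
  proof
    fix f assume f: "f \<in> s"
    obtain v where v: "v \<in> f"
      using f s(3) by (metis ex_in_conv)
    have "(u, v) \<in> {(a, b). {a, b} \<in> s}\<^sup>*"
      using s(1) e(1) u f v unfolding connected_graph_def by blast
    then show "f \<in> c"
      using reach f v s(2) disj by blast
  qed
qed

text \<open>Each copy of \<open>k\<close> is connected, hence lies in one part; it has an edge,
  hence cannot lie in both.\<close>

lemma subgraph_count_disjoint_Un: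
  assumes cd: "c \<union> d \<in> simple_graphs n" and disj: "\<Union>c \<inter> \<Union>d = {}" and k: "connected_graph k"
  shows "subgraph_count n k (c \<union> d) = subgraph_count n k c + subgraph_count n k d"
proof -
  let ?S = "\<lambda>x. {s. s \<subseteq> x \<and> graph_iso n k s}"
  have ne: "{} \<notin> c \<union> d"
  proof
    assume "{} \<in> c \<union> d"
    then have "card ({} :: nat set) = 2"
      using cd unfolding simple_graphs_def by blast
    then show False by simp
  qed
  have conn: "connected_graph s" if "graph_iso n k s" for s
    using connected_graph_iso[OF k that] .
  have "s \<subseteq> c \<or> s \<subseteq> d" if "s \<in> ?S (c \<union> d)" for s
    using that ne conn by (intro connected_subgraph_disjoint_Un[OF _ _ _ disj]) auto
  then have "?S (c \<union> d) = ?S c \<union> ?S d"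
    by blast
  moreover have "?S c \<inter> ?S d = {}"
  proof -
    have "\<not> (s \<subseteq> c \<and> s \<subseteq> d)" if "connected_graph s" for s
    proof
      assume s: "s \<subseteq> c \<and> s \<subseteq> d"
      obtain e where e: "e \<in> s"
        using \<open>connected_graph s\<close> unfolding connected_graph_def by blast
      then have "e \<subseteq> \<Union>c \<inter> \<Union>d"
        using s by blast
      then show False
        using e s ne disj by auto
    qed
    then show ?thesis
      using conn by blast
  qed
  moreover have "finite (?S c)" "finite (?S d)"
    using finite_simple_graph[OF cd] by simp_all
  ultimately show ?thesis
    unfolding subgraph_count_def by (simp add: card_Un_disjoint)
qed

section \<open>Reconstruction from connected counts\<close>

text \<open>Quantifying over all connected \<open>k\<close>, with no family in sight, lets the
  hypothesis pass unchanged to the remainders \<open>x - c\<close> and \<open>y - c'\<close> in the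
  induction.\<close>

theorem graph_iso_if_connected_counts_eq:
  assumes "x \<in> simple_graphs n" "y \<in> simple_graphs n"
    and "\<And>k. k \<in> simple_graphs n \<Longrightarrow> connected_graph k \<Longrightarrow>
      subgraph_count n k x = subgraph_count n k y"
  shows "graph_iso n x y"
  using assms
proof (induction "card x" arbitrary: x y rule: less_induct)
  case less
  note x = less.prems(1) and y = less.prems(2) and eq = less.prems(3)
  \<comment> \<open>Connected subgraphs have equally large copies on the other side, because their
    count there is positive too. The equation of unordered pairs makes this usable in both
    directions.\<close>
  have transfer: "\<exists>s\<subseteq>x'. graph_iso n k s \<and> connected_graph s \<and> card s = card k"
    if "k \<subseteq> y'" "connected_graph k" "{x', y'} = {x, y}" for k x' y'
  proof -
    have xy': "x' \<in> simple_graphs n" "y' \<in> simple_graphs n"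
      using that(3) x y by (auto simp: doubleton_eq_iff)
    have k: "k \<in> simple_graphs n"
      using simple_graphs_subset[OF xy'(2) that(1)] .
    have "0 < subgraph_count n k y'"
      using subgraph_count_pos_iff[OF xy'(2)] that(1) graph_iso_refl by blast
    then have "0 < subgraph_count n k x'"
      using eq[OF k that(2)] that(3) by (auto simp: doubleton_eq_iff)
    then obtain s where s: "s \<subseteq> x'" "graph_iso n k s"
      using subgraph_count_pos_iff[OF xy'(1)] by blast
    moreover have "card k = card s"
      using graph_iso_card_eq[OF k simple_graphs_subset[OF xy'(1) s(1)] s(2)] .
    ultimately show ?thesis
      using connected_graph_iso[OF that(2)] by auto
  qed
  show ?case
  proof (cases "x = {}")
    case True
    have "y = {}"
    proof (rule equals0I)
      fix e assume "e \<in> y"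
      then have "{e} \<subseteq> y" "connected_graph {e}"
        using y connected_graph_single_edge by (auto simp: simple_graphs_def)
      from transfer[OF this refl] show False
        using True by simp
    qed
    with True show ?thesis
      by (simp add: graph_iso_refl)
  next
    case False
    let ?K = "{c. c \<subseteq> x \<and> connected_graph c}"
    have "finite ?K"
      using finite_simple_graph[OF x] by simp
    moreover have "?K \<noteq> {}"
    proof -
      obtain e where "e \<in> x" using False by blast
      then have "{e} \<in> ?K"
        using x connected_graph_single_edge by (auto simp: simple_graphs_def)
      then show ?thesis by blast
    qed
    ultimately obtain c where K: "c \<in> ?K" and Max: "Max (card ` ?K) = card c"
      by (rule obtains_MAX)
    have c: "c \<subseteq> x" "connected_graph c"
      using K by simp_all
    have max: "card d \<le> card c" if "d \<subseteq> x" "connected_graph d" for d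
      unfolding Max[symmetric] using that \<open>finite ?K\<close> by (intro Max_ge) simp_all
    obtain c' where c': "c' \<subseteq> y" "graph_iso n c c'" "connected_graph c'" "card c' = card c"
      using transfer[OF c insert_commute] by blast
    \<comment> \<open>A larger connected subgraph of \<open>y\<close> would have a copy in
      \<open>x\<close> exceeding \<open>c\<close>.\<close>
    have max': "card d \<le> card c'" if d: "d \<subseteq> y" "connected_graph d" for d
    proof -
      obtain s where "s \<subseteq> x" "connected_graph s" "card s = card d"
        using transfer[OF d refl] by blast
      then show ?thesis
        using max c'(4) by metis
    qed
    have sg: "c \<in> simple_graphs n" "c' \<in> simple_graphs n"
      "x - c \<in> simple_graphs n" "y - c' \<in> simple_graphs n"
      using simple_graphs_subset[OF x] simple_graphs_subset[OF y] c(1) c'(1) by auto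
    have disj: "\<Union>c \<inter> \<Union>(x - c) = {}"
      using maximal_connected_subgraph_disjoint[OF x c max] .
    have disj': "\<Union>c' \<inter> \<Union>(y - c') = {}"
      using maximal_connected_subgraph_disjoint[OF y c'(1,3) max'] .
    have x_eq: "c \<union> (x - c) = x" and y_eq: "c' \<union> (y - c') = y"
      using c(1) c'(1) by auto
    have "graph_iso n (x - c) (y - c')"
    proof (rule less.hyps[OF _ sg(3,4)])
      have "x - c \<subset> x"
        using c unfolding connected_graph_def by blast
      then show "card (x - c) < card x"
        by (rule psubset_card_mono[OF finite_simple_graph[OF x]])
    next
      fix k assume k: "k \<in> simple_graphs n" "connected_graph k"
      \<comment> \<open>Isomorphic \<open>c\<close> and \<open>c'\<close> contribute equally, so by
        additivity their shares cancel from the counts in \<open>x\<close> and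
        \<open>y\<close>.\<close>
      have "subgraph_count n k c = subgraph_count n k c'"
        using subgraph_count_le[OF k(1) sg(1) graph_iso_refl c'(2)]
          subgraph_count_le[OF k(1) sg(2) graph_iso_refl graph_iso_sym[OF sg(1) c'(2)]] by simp
      moreover have "subgraph_count n k x = subgraph_count n k c + subgraph_count n k (x - c)"
        using subgraph_count_disjoint_Un[OF _ disj k(2)] x x_eq by simp
      moreover have "subgraph_count n k y = subgraph_count n k c' + subgraph_count n k (y - c')"
        using subgraph_count_disjoint_Un[OF _ disj' k(2)] y y_eq by simp
      ultimately show "subgraph_count n k (x - c) = subgraph_count n k (y - c')"
        using eq[OF k] by simp
    qed
    from graph_iso_disjoint_Un[OF sg c'(2) this disj disj'] show ?thesis
      unfolding x_eq y_eq .
  qed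
qed

text \<open>A connected \<open>k\<close> with a copy in one of the two representatives has its class
  in \<open>\<E>\<close> by closure; any other \<open>k\<close> has count zero in both.\<close>

lemma iso_classes_eq_if_connected_counts_eq:
  assumes \<E>: "\<E> \<subseteq> iso_classes n" "subgraph_closed n \<E>" and xy: "x \<in> \<E>" "y \<in> \<E>"
    and eq: "\<And>c. c \<in> \<E> \<Longrightarrow> connected_class c \<Longrightarrow> class_count n c x = class_count n c y"
  shows "x = y"
proof -
  obtain g h where g: "g \<in> simple_graphs n" "x = iso_class n g"
    and h: "h \<in> simple_graphs n" "y = iso_class n h"
    using \<E>(1) xy by (meson quotientE subsetD)
  have self: "k \<in> iso_class n k" if "k \<in> simple_graphs n" for k
    using equiv_class_self[OF equiv_iso_rel that] .
  have sub: "subgraph_count n k g = subgraph_count n k h"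
    if k: "k \<in> simple_graphs n" "connected_graph k" "s \<subseteq> z" "z \<in> {g, h}" "graph_iso n k s" for k s z
  proof -
    \<comment> \<open>Closure speaks of actual subgraphs, so the argument uses the copy
      \<open>s\<close> and returns to \<open>k\<close> at the end.\<close>
    let ?c = "iso_class n s"
    have "s \<in> simple_graphs n"
      using k(3,4) g(1) h(1) simple_graphs_subset by blast
    note s = this self[OF this]
    have "z \<in> x \<or> z \<in> y"
      using k(4) self[OF g(1)] self[OF h(1)] g(2) h(2) by auto
    then have c: "?c \<in> \<E>"
      using \<E>(2) xy k(3) unfolding subgraph_closed_def by blast
    then have iso: "?c \<in> iso_classes n" "x \<in> iso_classes n" "y \<in> iso_classes n"
      using \<E>(1) xy by auto
    have "connected_class ?c"
      using connected_class_iff[OF iso(1) s(2)] connected_graph_iso[OF k(2,5)] by simp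
    then have "class_count n ?c x = class_count n ?c y"
      by (rule eq[OF c])
    then have "subgraph_count n s g = subgraph_count n s h"
      using class_count_eq[OF iso(1,2) s(2), of g] class_count_eq[OF iso(1,3) s(2), of h]
        self[OF g(1)] self[OF h(1)] g(2) h(2) by simp
    then show ?thesis
      using subgraph_count_cong[OF k(1) s(1) _ k(5)] g(1) h(1) by simp
  qed
  have "subgraph_count n k g = subgraph_count n k h"
    if k: "k \<in> simple_graphs n" "connected_graph k" for k
  proof (cases "subgraph_count n k g = 0 \<and> subgraph_count n k h = 0")
    case False
    then obtain z where z: "z \<in> {g, h}" "0 < subgraph_count n k z"
      by auto
    have z_simple: "z \<in> simple_graphs n"
      using z(1) g(1) h(1) by blast
    obtain s where "s \<subseteq> z" "graph_iso n k s"
      using z(2) subgraph_count_pos_iff[OF z_simple] by blast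
    then show ?thesis
      using sub[OF k _ z(1)] by simp
  qed simp
  then have "graph_iso n g h"
    by (rule graph_iso_if_connected_counts_eq[OF g(1) h(1)])
  then show ?thesis
    using iso_class_eq_iff[OF g(1) h(1)] g(2) h(2) by simp
qed

theorem theorem18:
  fixes n :: nat and \<E> \<C> :: "graph set set"
  assumes "\<E> \<subseteq> iso_classes n"
    and "subgraph_closed n \<E>"
    and "\<C> = {c \<in> \<E>. connected_class c}"
  shows "(\<forall>x\<in>\<E>. \<forall>y\<in>\<E>. (\<forall>c\<in>\<C>. class_count n c x = class_count n c y) \<longrightarrow> x = y) \<and>
    (\<forall>h\<in>\<E>. \<exists>f :: (graph set \<Rightarrow> nat) \<Rightarrow> nat.
      \<forall>x\<in>\<E>. class_count n h x = f (\<lambda>c\<in>\<C>. class_count n c x))"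
proof -
  let ?v = "\<lambda>x. \<lambda>c\<in>\<C>. class_count n c x"
  have sep: "x = y" if "x \<in> \<E>" "y \<in> \<E>" "\<forall>c\<in>\<C>. class_count n c x = class_count n c y" for x y
    using iso_classes_eq_if_connected_counts_eq[OF assms(1,2) that(1,2)] that(3) assms(3) by simp
  \<comment> \<open>Separation says exactly that the vector of connected counts, restricted to
    \<open>\<C>\<close>, determines the class.\<close>
  have inj: "inj_on ?v \<E>"
    by (intro inj_onI sep) (auto simp: restrict_def fun_eq_iff split: if_splits)
  \<comment> \<open>The witness \<open>f\<close> recovers \<open>x\<close> from its vector and then
    counts \<open>h\<close> in it; its values off the image of \<open>\<E>\<close> do not
    matter.\<close>
  have "class_count n h x = (class_count n h \<circ> inv_into \<E> ?v) (?v x)" if "x \<in> \<E>" for h x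
    using inv_into_f_f[OF inj that] by simp
  with sep show ?thesis by blast
qed

end
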